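(* Let $n$ be a positive integer. Let $\phi:G_{n,p}^2\to G_{n,d}^2$ be the homomorphism given, for $i<j$, by $\phi(a_{ij}^{0})=a_{ij}$ and $\phi(a_{ij}^{1})=\tau_{i}a_{ij}\tau_{i}$, and let $\omega : G_{n,d}^{2}\rightarrow G_{n+1}^{2}/\langle a_{i(n+1)}a_{j(n+1)}=a_{j(n+1)}a_{i(n+1)}\rangle$ be the homomorphism given by $\omega(a_{ij})=a_{ij}$ and $\omega(\tau_{i})=a_{i(n+1)}$. Then the composition $\omega\circ\phi$ is a monomorphism from $G_{n,p}^{2}$ to $G_{n+1}^{2}/\langle a_{i(n+1)}a_{j(n+1)}=a_{j(n+1)}a_{i(n+1)}\rangle$.
   Context: Convention: generators are indexed by unordered pairs, so $a_{ji}$ means $a_{ij}$ and $a_{ji}^{\epsilon}$ means $a_{ij}^{\epsilon}$; the superscript $\epsilon\in\{0,1\}$ in $a_{ij}^{\epsilon}$ is a label, not a power. For a positive integer $m$, $G_{m}^{2}$ is the group with generators $a_{ij}$ for $\{i,j\}\subset\{1,\dots,m\}$, $i<j$, and relations: (1) $a_{ij}^{2}=1$ for all $i\neq j$; (2) $a_{ij}a_{kl}=a_{kl}a_{ij}$ for distinct $i,j,k,l$; (3) $a_{ij}a_{ik}a_{jk}=a_{jk}a_{ik}a_{ij}$ for distinct $i,j,k$. $G_{n+1}^{2}/\langle a_{i(n+1)}a_{j(n+1)}=a_{j(n+1)}a_{i(n+1)}\rangle$ denotes the quotient of $G_{n+1}^{2}$ obtained by adding the relations $a_{i(n+1)}a_{j(n+1)}=a_{j(n+1)}a_{i(n+1)}$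 for all $i,j\in\{1,\dots,n\}$; images of generators in the quotient are denoted by the same symbols. $G_{n,p}^{2}$ ($G_n^2$ with parity) is the group with generators $a_{ij}^{\epsilon}$ for $\{i,j\}\subset\{1,\dots,n\}$, $i<j$, $\epsilon\in\{0,1\}$, and relations: (1) $(a_{ij}^{\epsilon})^{2}=1$ for all $i\ne j$ and $\epsilon\in\{0,1\}$; (2) $a_{ij}^{\epsilon_{ij}}a_{kl}^{\epsilon_{kl}}=a_{kl}^{\epsilon_{kl}}a_{ij}^{\epsilon_{ij}}$ for distinct $i,j,k,l$ and all $\epsilon_{ij},\epsilon_{kl}\in\{0,1\}$; (3) $a_{ij}^{\epsilon_{ij}}a_{ik}^{\epsilon_{ik}}a_{jk}^{\epsilon_{jk}}=a_{jk}^{\epsilon_{jk}}a_{ik}^{\epsilon_{ik}}a_{ij}^{\epsilon_{ij}}$ for distinct $i,j,k$ and all $\epsilon_{ij},\epsilon_{ik},\epsilon_{jk}\in\{0,1\}$ with $\epsilon_{ij}+\epsilon_{ik}+\epsilon_{jk}\equiv 0 \pmod 2$. $G_{n,d}^{2}$ ($G_n^2$ with points) is the group with generators $a_{ij}$ for $\{i,j\}\subset\{1,\dots,n\}$, $i<j$, and $\tau_{i}$ for $i\in\{1,\dots,n\}$, and relations: (1) $a_{ij}^{2}=1$ for $i\neq j$; (2) $a_{ij}a_{kl}=a_{kl}a_{ij}$ for distinct $i,j,k,l$; (3) $a_{ij}a_{ik}a_{jk}=a_{jk}a_{ik}a_{ij}$ for distinct $i,j,k$; (4) $\tau_{i}^{2}=1$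 for all $i$; (5) $\tau_{i}\tau_{j}=\tau_{j}\tau_{i}$ for all $i,j$; (6) $\tau_{i}\tau_{j}a_{ij}\tau_{j}\tau_{i}=a_{ij}$ for distinct $i,j$; (7) $a_{ij}\tau_{k}=\tau_{k}a_{ij}$ for distinct $i,j,k$. *)

theory Defs
  imports "HOL-Algebra.Group"
begin

section \<open>Groups given by generators and relations\<close>

text \<open>The letter \<open>(g, True)\<close> stands for the generator \<open>g\<close> and \<open>(g, False)\<close> for its formal
  inverse. A relation \<open>(u, v)\<close> is the equation \<open>u = v\<close>.\<close>

type_synonym 'g word = "('g \<times> bool) list"
type_synonym 'g presentation = "'g set \<times> ('g word \<times> 'g word) set"

definition words :: "'g set \<Rightarrow> 'g word set" where
  "words S = lists (S \<times> UNIV)"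

definition pos :: "'g list \<Rightarrow> 'g word" where
  "pos gs = map (\<lambda>g. (g, True)) gs"

text \<open>Two words are identified when one can be transformed into the other by inserting and
  deleting \<open>g g\<inverse>\<close> and \<open>g\<inverse> g\<close> and by applying relations to subwords.\<close>

inductive pres_eq :: "'g presentation \<Rightarrow> 'g word \<Rightarrow> 'g word \<Rightarrow> bool"
  for P :: "'g presentation" where
  refl: "w \<in> words (fst P) \<Longrightarrow> pres_eq P w w"
| sym: "pres_eq P u v \<Longrightarrow> pres_eq P v u"
| trans: "pres_eq P u v \<Longrightarrow> pres_eq P v w \<Longrightarrow> pres_eq P u w"
| mult: "pres_eq P u u' \<Longrightarrow> pres_eq P v v' \<Longrightarrow> pres_eq P (u @ v) (u' @ v')"
| cancel: "g \<in> fst P \<Longrightarrow> pres_eq P [(g, b), (g, \<not> b)] []"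
| rel: "(u, v) \<in> snd P \<Longrightarrow> u \<in> words (fst P) \<Longrightarrow> v \<in> words (fst P) \<Longrightarrow> pres_eq P u v"

definition word_class :: "'g presentation \<Rightarrow> 'g word \<Rightarrow> 'g word set" where
  "word_class P w = {v. pres_eq P w v}"

definition presented_group :: "'g presentation \<Rightarrow> 'g word set monoid" where
  "presented_group P =
    \<lparr>carrier = word_class P ` words (fst P),
     mult = (\<lambda>X Y. {w. \<exists>u\<in>X. \<exists>v\<in>Y. pres_eq P (u @ v) w}),
     one = word_class P []\<rparr>"

definition gen :: "'g presentation \<Rightarrow> 'g \<Rightarrow> 'g word set" where
  "gen P g = word_class P [(g, True)]"

lemma words_Nil [simp]: "[] \<in> words S"
  by (simp add: words_def)

lemma words_Cons [simp]: "x # w \<in> words S \<longleftrightarrow> fst x \<in> S \<and> w \<in> words S"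
  by (cases x) (auto simp: words_def)

lemma words_append [simp]: "u @ v \<in> words S \<longleftrightarrow> u \<in> words S \<and> v \<in> words S"
  by (auto simp: words_def)

lemma pres_eq_words: "pres_eq P u v \<Longrightarrow> u \<in> words (fst P) \<and> v \<in> words (fst P)"
  by (induction rule: pres_eq.induct) auto

lemma word_class_eq_iff:
  assumes "u \<in> words (fst P)"
  shows "word_class P u = word_class P v \<longleftrightarrow> pres_eq P u v"
  unfolding word_class_def using assms by (blast intro: pres_eq.intros)

lemma mult_word_class:
  assumes "u \<in> words (fst P)" "v \<in> words (fst P)"
  shows "word_class P u \<otimes>\<^bsub>presented_group P\<^esub> word_class P v = word_class P (u @ v)"
  unfolding presented_group_def word_class_def using assms
  by (auto intro: pres_eq.intros)

lemma inverse_word: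
  assumes "w \<in> words (fst P)"
  shows "\<exists>v \<in> words (fst P). pres_eq P (v @ w) []"
  using assms
proof (induction w)
  case Nil
  then show ?case by (auto intro!: bexI[of _ "[]"] pres_eq.refl)
next
  case (Cons x w)
  then obtain v where v: "v \<in> words (fst P)" "pres_eq P (v @ w) []" by auto
  obtain g b where x: "x = (g, b)" by force
  with Cons have g: "g \<in> fst P" "w \<in> words (fst P)" by auto
  let ?v = "v @ [(g, \<not> b)]"
  have "pres_eq P [(g, \<not> b), (g, b)] []"
    using pres_eq.cancel[OF g(1), of "\<not> b"] by simp
  then have "pres_eq P (v @ [(g, \<not> b), (g, b)] @ w) (v @ [] @ w)"
    using v g by (intro pres_eq.mult pres_eq.refl) auto
  then have "pres_eq P (?v @ x # w) []"
    using v(2) x by (auto intro: pres_eq.trans)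
  then show ?case using v g by (intro bexI[of _ ?v]) auto
qed

lemma group_presented_group: "group (presented_group P)"
proof -
  have carr: "carrier (presented_group P) = word_class P ` words (fst P)"
    and one: "\<one>\<^bsub>presented_group P\<^esub> = word_class P []"
    by (simp_all add: presented_group_def)
  have inv: "\<exists>y\<in>carrier (presented_group P). y \<otimes>\<^bsub>presented_group P\<^esub> x = \<one>\<^bsub>presented_group P\<^esub>"
    if x: "x \<in> carrier (presented_group P)" for x
  proof -
    obtain w where w: "w \<in> words (fst P)" "x = word_class P w"
      using x by (auto simp: carr)
    obtain v where v: "v \<in> words (fst P)" "pres_eq P (v @ w) []"
      using inverse_word[OF w(1)] by blast
    show ?thesis
      using w v by (intro bexI[of _ "word_class P v"])
        (auto simp: carr one mult_word_class word_class_eq_iff)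
  qed
  show ?thesis
    by (rule groupI) (use inv in \<open>auto simp: carr one mult_word_class\<close>)
qed

section \<open>The groups $G_m^2$, $G_{n,p}^2$ and $G_{n,d}^2$\<close>

text \<open>A generator indexed by an unordered pair is represented by the set \<open>{i, j}\<close>, so the
  convention \<open>a\<^sub>j\<^sub>i = a\<^sub>i\<^sub>j\<close> holds definitionally.\<close>

definition pairs :: "nat \<Rightarrow> nat set set" where
  "pairs m = {{i, j} | i j. i \<in> {1..m} \<and> j \<in> {1..m} \<and> i < j}"

definition G2_pres :: "nat \<Rightarrow> nat set presentation" where
  "G2_pres m = (pairs m,
     {(pos [{i,j}, {i,j}], []) | i j. {i,j} \<subseteq> {1..m} \<and> i \<noteq> j}
   \<union> {(pos [{i,j}, {k,l}], pos [{k,l}, {i,j}]) | i j k l.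
        {i,j,k,l} \<subseteq> {1..m} \<and> distinct [i,j,k,l]}
   \<union> {(pos [{i,j}, {i,k}, {j,k}], pos [{j,k}, {i,k}, {i,j}]) | i j k.
        {i,j,k} \<subseteq> {1..m} \<and> distinct [i,j,k]})"

text \<open>The quotient of $G_{n+1}^2$ that adds the commutation of all \<open>a\<^sub>i\<^sub>,\<^sub>n\<^sub>+\<^sub>1\<close>.\<close>

definition G2_quot_pres :: "nat \<Rightarrow> nat set presentation" where
  "G2_quot_pres n = (fst (G2_pres (n+1)), snd (G2_pres (n+1))
     \<union> {(pos [{i,n+1}, {j,n+1}], pos [{j,n+1}, {i,n+1}]) | i j. {i,j} \<subseteq> {1..n}})"

definition G2_parity_pres :: "nat \<Rightarrow> (nat set \<times> nat) presentation" where
  "G2_parity_pres n = (pairs n \<times> {0,1},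
     {(pos [({i,j},e), ({i,j},e)], []) | i j e. {i,j} \<subseteq> {1..n} \<and> i \<noteq> j \<and> e \<in> {0,1}}
   \<union> {(pos [({i,j},e), ({k,l},f)], pos [({k,l},f), ({i,j},e)]) | i j k l e f.
        {i,j,k,l} \<subseteq> {1..n} \<and> distinct [i,j,k,l] \<and> {e,f} \<subseteq> {0,1}}
   \<union> {(pos [({i,j},e), ({i,k},f), ({j,k},g)], pos [({j,k},g), ({i,k},f), ({i,j},e)]) | i j k e f g.
        {i,j,k} \<subseteq> {1..n} \<and> distinct [i,j,k] \<and> {e,f,g} \<subseteq> {0,1} \<and> (e + f + g) mod 2 = 0})"

datatype point_gen = Arc "nat set" | Tau nat

definition G2_points_pres :: "nat \<Rightarrow> point_gen presentation" where
  "G2_points_pres n = (Arc ` pairs n \<union> Tau ` {1..n},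
     {(pos [Arc {i,j}, Arc {i,j}], []) | i j. {i,j} \<subseteq> {1..n} \<and> i \<noteq> j}
   \<union> {(pos [Arc {i,j}, Arc {k,l}], pos [Arc {k,l}, Arc {i,j}]) | i j k l.
        {i,j,k,l} \<subseteq> {1..n} \<and> distinct [i,j,k,l]}
   \<union> {(pos [Arc {i,j}, Arc {i,k}, Arc {j,k}], pos [Arc {j,k}, Arc {i,k}, Arc {i,j}]) | i j k.
        {i,j,k} \<subseteq> {1..n} \<and> distinct [i,j,k]}
   \<union> {(pos [Tau i, Tau i], []) | i. i \<in> {1..n}}
   \<union> {(pos [Tau i, Tau j], pos [Tau j, Tau i]) | i j. {i,j} \<subseteq> {1..n}}
   \<union> {(pos [Tau i, Tau j, Arc {i,j}, Tau j, Tau i], pos [Arc {i,j}]) | i j.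
        {i,j} \<subseteq> {1..n} \<and> i \<noteq> j}
   \<union> {(pos [Arc {i,j}, Tau k], pos [Tau k, Arc {i,j}]) | i j k.
        {i,j,k} \<subseteq> {1..n} \<and> distinct [i,j,k]})"

definition G2_quot :: "nat \<Rightarrow> nat set word set monoid" where
  "G2_quot n = presented_group (G2_quot_pres n)"

definition G2_parity :: "nat \<Rightarrow> (nat set \<times> nat) word set monoid" where
  "G2_parity n = presented_group (G2_parity_pres n)"

definition G2_points :: "nat \<Rightarrow> point_gen word set monoid" where
  "G2_points n = presented_group (G2_points_pres n)"

section \<open>The two homomorphisms\<close>

definition is_phi ::
    "nat \<Rightarrow> ((nat set \<times> nat) word set \<Rightarrow> point_gen word set) \<Rightarrow> bool" where
  "is_phi n \<phi> \<longleftrightarrow> \<phi> \<in> hom (G2_parity n) (G2_points n) \<and>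
     (\<forall>i j. i \<in> {1..n} \<and> j \<in> {1..n} \<and> i < j \<longrightarrow>
        \<phi> (gen (G2_parity_pres n) ({i,j}, 0)) = gen (G2_points_pres n) (Arc {i,j}) \<and>
        \<phi> (gen (G2_parity_pres n) ({i,j}, 1)) =
          gen (G2_points_pres n) (Tau i) \<otimes>\<^bsub>G2_points n\<^esub> gen (G2_points_pres n) (Arc {i,j})
            \<otimes>\<^bsub>G2_points n\<^esub> gen (G2_points_pres n) (Tau i))"

definition is_omega :: "nat \<Rightarrow> (point_gen word set \<Rightarrow> nat set word set) \<Rightarrow> bool" where
  "is_omega n \<omega> \<longleftrightarrow> \<omega> \<in> hom (G2_points n) (G2_quot n) \<and>
     (\<forall>i j. i \<in> {1..n} \<and> j \<in> {1..n} \<and> i < j \<longrightarrow>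
        \<omega> (gen (G2_points_pres n) (Arc {i,j})) = gen (G2_quot_pres n) {i,j}) \<and>
     (\<forall>i\<in>{1..n}. \<omega> (gen (G2_points_pres n) (Tau i)) = gen (G2_quot_pres n) {i,n+1})"

end

theory Submission
  imports Defs
begin

text \<open>Sending \<open>a\<^sub>i\<^sub>j\<close> to \<open>a\<^sub>i\<^sub>j\<^sup>0\<close> and \<open>a\<^sub>i\<^sub>,\<^sub>n\<^sub>+\<^sub>1\<close> to the \<open>i\<close>-th generator of $(Z/2)^n$ maps the quotient
  of $G_{n+1}^2$ to the semidirect product of $G_{n,p}^2$ with $(Z/2)^n$, where the \<open>i\<close>-th generator
  flips the parity of every \<open>a\<^sub>i\<^sub>j\<close>; on the image of $G_{n,p}^2$ this inverts the composition.
  On words it has a direct description: read the word from left to right, keep the set \<open>s\<close> of those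
  \<open>i\<close> for which \<open>a\<^sub>i\<^sub>,\<^sub>n\<^sub>+\<^sub>1\<close> has occurred an odd number of times, and label each \<open>a\<^sub>i\<^sub>j\<close> by the parity
  of \<open>{i, j} \<inter> s\<close>.\<close>

section \<open>Homomorphisms from a presented group\<close>

lemma presented_group_simps:
  "carrier (presented_group P) = word_class P ` words (fst P)"
  "\<one>\<^bsub>presented_group P\<^esub> = word_class P []"
  by (simp_all add: presented_group_def)

lemma word_class_carrier:
  "w \<in> words (fst P) \<Longrightarrow> word_class P w \<in> carrier (presented_group P)"
  by (simp add: presented_group_simps)

lemma gen_carrier: "g \<in> fst P \<Longrightarrow> gen P g \<in> carrier (presented_group P)"
  by (simp add: gen_def word_class_carrier)

lemma pos_simps [simp]: "pos [] = []" "pos (g # gs) = (g, True) # pos gs"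
  by (simp_all add: pos_def)

lemma pos_words [simp]: "pos gs \<in> words S \<longleftrightarrow> set gs \<subseteq> S"
  by (induction gs) auto

lemma word_class_pos:
  "set gs \<subseteq> fst P \<Longrightarrow> word_class P (pos gs) =
     foldr (\<lambda>g x. gen P g \<otimes>\<^bsub>presented_group P\<^esub> x) gs \<one>\<^bsub>presented_group P\<^esub>"
proof (induction gs)
  case Nil
  then show ?case by (simp add: presented_group_simps)
next
  case (Cons g gs)
  then have "word_class P (pos (g # gs)) =
      word_class P [(g, True)] \<otimes>\<^bsub>presented_group P\<^esub> word_class P (pos gs)"
    using mult_word_class[of "[(g, True)]" P "pos gs"] by simp
  with Cons show ?case by (simp add: gen_def)
qed

text \<open>The products are folds over lists so that, for a concrete relation, simplification
  unfolds them into an equation between generators.\<close>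

lemma relation_gens:
  assumes "(pos us, pos vs) \<in> snd P" "set us \<subseteq> fst P" "set vs \<subseteq> fst P"
  shows "foldr (\<lambda>g x. gen P g \<otimes>\<^bsub>presented_group P\<^esub> x) us \<one>\<^bsub>presented_group P\<^esub> =
    foldr (\<lambda>g x. gen P g \<otimes>\<^bsub>presented_group P\<^esub> x) vs \<one>\<^bsub>presented_group P\<^esub>"
proof -
  have "pres_eq P (pos us) (pos vs)"
    using assms by (intro pres_eq.rel) auto
  then show ?thesis
    using assms by (simp add: word_class_eq_iff flip: word_class_pos)
qed

lemma word_class_inverse_letter:
  assumes "g \<in> fst P"
  shows "word_class P [(g, False)] = inv\<^bsub>presented_group P\<^esub> gen P g"
proof -
  interpret group "presented_group P" by (rule group_presented_group)
  have "word_class P [(g, False)] \<otimes>\<^bsub>presented_group P\<^esub> gen P g = \<one>\<^bsub>presented_group P\<^esub>"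
    using assms pres_eq.cancel[of g P False]
    by (simp add: gen_def mult_word_class word_class_eq_iff presented_group_simps)
  then show ?thesis
    using assms by (intro inv_equality[symmetric]) (auto intro: gen_carrier word_class_carrier)
qed

section \<open>Evaluation of words and von Dyck's theorem\<close>

definition eval_word :: "('a, 'b) monoid_scheme \<Rightarrow> ('g \<Rightarrow> 'a) \<Rightarrow> 'g word \<Rightarrow> 'a" where
  "eval_word K f w =
     foldr (\<lambda>(g, b) x. (if b then f g else inv\<^bsub>K\<^esub> f g) \<otimes>\<^bsub>K\<^esub> x) w \<one>\<^bsub>K\<^esub>"

lemma eval_word_simps [simp]:
  "eval_word K f [] = \<one>\<^bsub>K\<^esub>"
  "eval_word K f ((g, b) # w) = (if b then f g else inv\<^bsub>K\<^esub> f g) \<otimes>\<^bsub>K\<^esub> eval_word K f w"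
  by (simp_all add: eval_word_def)

context group
begin

lemma eval_word_closed [simp]:
  assumes "f \<in> S \<rightarrow> carrier G"
  shows "w \<in> words S \<Longrightarrow> eval_word G f w \<in> carrier G"
  using assms by (induction w) (auto simp: Pi_iff)

lemma eval_word_append:
  assumes "f \<in> S \<rightarrow> carrier G" "v \<in> words S"
  shows "u \<in> words S \<Longrightarrow> eval_word G f (u @ v) = eval_word G f u \<otimes> eval_word G f v"
proof (induction u)
  case Nil
  then show ?case using assms by simp
next
  case (Cons x u)
  moreover obtain g b where "x = (g, b)" by force
  moreover have "eval_word G f u \<in> carrier G" "eval_word G f v \<in> carrier G"
    using assms Cons.prems by auto
  ultimately show ?case
    using assms by (auto simp: m_assoc Pi_iff)
qed

text \<open>Von Dyck's theorem. Evaluation respects every rule generating \<open>pres_eq\<close>,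
  hence is constant on classes and descends to the presented group.\<close>

theorem presented_group_universal:
  assumes f: "f \<in> fst P \<rightarrow> carrier G"
    and rel: "\<And>u v. (u, v) \<in> snd P \<Longrightarrow> eval_word G f u = eval_word G f v"
  shows "\<exists>h \<in> hom (presented_group P) G. \<forall>g \<in> fst P. h (gen P g) = f g"
proof -
  have eq: "eval_word G f u = eval_word G f v" if "pres_eq P u v" for u v
    using that
  proof induction
    case (mult u u' v v')
    then show ?case
      using f by (auto simp: eval_word_append[where S = "fst P"] dest!: pres_eq_words)
  next
    case (cancel g b)
    then have "f g \<in> carrier G" using f by auto
    then show ?case by (cases b) simp_all
  qed (use rel in auto)
  \<comment> \<open>The choice of a representative is harmless: by \<open>eq\<close>, all words of a
    class have the same value.\<close>
  define h where "h X = eval_word G f (SOME w. w \<in> X)" for X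
  have h: "h (word_class P w) = eval_word G f w" if "w \<in> words (fst P)" for w
  proof -
    have "w \<in> word_class P w"
      using that by (simp add: word_class_def pres_eq.refl)
    then have "(SOME v. v \<in> word_class P w) \<in> word_class P w" by (rule someI)
    then show ?thesis
      unfolding h_def word_class_def by (auto dest: eq)
  qed
  have "h \<in> hom (presented_group P) G"
    using f by (intro homI)
      (auto simp: presented_group_simps h mult_word_class eval_word_append[where S = "fst P"])
  moreover have "h (gen P g) = f g" if "g \<in> fst P" for g
  proof -
    have "f g \<in> carrier G" using f that by blast
    then show ?thesis using that by (simp add: gen_def h)
  qed
  ultimately show ?thesis by blast
qed

end

section \<open>Existence of the two homomorphisms\<close>

lemma pairs_iff: "{i, j} \<in> pairs m \<longleftrightarrow> i \<in> {1..m} \<and> j \<in> {1..m} \<and> i \<noteq> j"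
  by (auto simp: pairs_def doubleton_eq_iff) (metis linorder_neqE_nat)+

lemma pairs_cases:
  assumes "e \<in> pairs m"
  obtains i j where "e = {i, j}" "i \<in> {1..m}" "j \<in> {1..m}" "i < j"
  using assms by (auto simp: pairs_def)

text \<open>The seven families of relations of $G_{n,d}^2$, required of elements \<open>A e\<close>
  and \<open>T i\<close> of an arbitrary group. Taking \<open>K\<close> to be $G_{n,d}^2$ itself
  yields the first homomorphism, taking the quotient of $G_{n+1}^2$ yields the second.\<close>

locale points_relations = group K for K (structure) +
  fixes n :: nat and A :: "nat set \<Rightarrow> 'a" and T :: "nat \<Rightarrow> 'a"
  assumes A_closed [simp]: "e \<in> pairs n \<Longrightarrow> A e \<in> carrier K"
    and T_closed [simp]: "i \<in> {1..n} \<Longrightarrow> T i \<in> carrier K"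
    and A_square: "e \<in> pairs n \<Longrightarrow> A e \<otimes> A e = \<one>"
    and A_commute: "\<lbrakk>{i,j,k,l} \<subseteq> {1..n}; distinct [i,j,k,l]\<rbrakk>
      \<Longrightarrow> A {i,j} \<otimes> A {k,l} = A {k,l} \<otimes> A {i,j}"
    and A_triangle: "\<lbrakk>{i,j,k} \<subseteq> {1..n}; distinct [i,j,k]\<rbrakk>
      \<Longrightarrow> A {i,j} \<otimes> A {i,k} \<otimes> A {j,k} = A {j,k} \<otimes> A {i,k} \<otimes> A {i,j}"
    and T_square: "i \<in> {1..n} \<Longrightarrow> T i \<otimes> T i = \<one>"
    and T_commute: "{i,j} \<subseteq> {1..n} \<Longrightarrow> T i \<otimes> T j = T j \<otimes> T i"
    and T_conj_A: "\<lbrakk>{i,j} \<subseteq> {1..n}; i \<noteq> j\<rbrakk>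
      \<Longrightarrow> T i \<otimes> T j \<otimes> A {i,j} \<otimes> T j \<otimes> T i = A {i,j}"
    and A_T_commute: "\<lbrakk>{i,j,k} \<subseteq> {1..n}; distinct [i,j,k]\<rbrakk>
      \<Longrightarrow> A {i,j} \<otimes> T k = T k \<otimes> A {i,j}"
begin

section \<open>Conjugation by the \<open>T i\<close> and the labelled arcs\<close>

lemma T_cancel: "\<lbrakk>i \<in> {1..n}; x \<in> carrier K\<rbrakk> \<Longrightarrow> T i \<otimes> (T i \<otimes> x) = x"
  by (simp add: T_square flip: m_assoc)

lemma T_conj_mult:
  assumes "x \<in> {1..n}" "a \<in> carrier K" "b \<in> carrier K"
  shows "T x \<otimes> a \<otimes> T x \<otimes> (T x \<otimes> b \<otimes> T x) = T x \<otimes> (a \<otimes> b) \<otimes> T x"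
  using assms by (simp add: m_assoc T_cancel)

text \<open>Relation \<open>T_conj_A\<close> makes label \<open>1\<close> symmetric in
  \<open>i\<close> and \<open>j\<close>, although the homomorphism is stated with the smaller
  index.\<close>

lemma T_conj_swap:
  assumes "i \<in> {1..n}" "j \<in> {1..n}" "i \<noteq> j"
  shows "T i \<otimes> A {i,j} \<otimes> T i = T j \<otimes> A {i,j} \<otimes> T j"
proof -
  have "T i \<otimes> A {i,j} \<otimes> T i = T i \<otimes> (T i \<otimes> T j \<otimes> A {i,j} \<otimes> T j \<otimes> T i) \<otimes> T i"
    using T_conj_A assms by simp
  also have "\<dots> = T j \<otimes> A {i,j} \<otimes> T j"
    using assms by (simp add: m_assoc T_cancel T_square pairs_iff)
  finally show ?thesis .
qed

text \<open>The prospective image of a generator with parity. An unordered pair has no first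
  element, so \<open>Min e\<close> supplies the smaller index, by which the first homomorphism
  conjugates.\<close>

definition arc :: "nat set \<times> nat \<Rightarrow> 'a" where
  "arc = (\<lambda>(e, p). if p = 0 then A e else T (Min e) \<otimes> A e \<otimes> T (Min e))"

lemma arc_0 [simp]: "arc (e, 0) = A e"
  by (simp add: arc_def)

lemma arc_1:
  assumes "e \<in> pairs n" "x \<in> e"
  shows "arc (e, Suc 0) = T x \<otimes> A e \<otimes> T x"
proof -
  obtain i j where e: "e = {i, j}" "i \<in> {1..n}" "j \<in> {1..n}" "i < j"
    using assms(1) by (rule pairs_cases)
  then have "arc (e, Suc 0) = T i \<otimes> A e \<otimes> T i" by (simp add: arc_def min_def)
  with e assms(2) T_conj_swap[of i j] show ?thesis by auto
qed

lemma arc_closed: "arc \<in> pairs n \<times> {0,1} \<rightarrow> carrier K"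
proof -
  have "arc (e, p) \<in> carrier K" if e: "e \<in> pairs n" for e p
  proof -
    have "Min e \<in> {1..n}"
      using e by (rule pairs_cases) (auto simp: min_def)
    with e show ?thesis by (simp add: arc_def)
  qed
  then show ?thesis by auto
qed

text \<open>An endpoint \<open>x\<close> turns label \<open>0\<close> into label \<open>1\<close> by
  \<open>arc_1\<close>; any other \<open>x\<close> gives a \<open>T x\<close> commuting with
  \<open>A e\<close>, and its two copies cancel.\<close>

lemma T_conj_arc:
  assumes "x \<in> {1..n}" "e \<in> pairs n"
  shows "T x \<otimes> A e \<otimes> T x = arc (e, of_bool (x \<in> e))"
proof (cases "x \<in> e")
  case True
  then show ?thesis using assms by (simp add: arc_1)
next
  case False
  obtain i j where e: "e = {i, j}" "i \<in> {1..n}" "j \<in> {1..n}" "i < j"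
    using assms(2) by (rule pairs_cases)
  have "T x \<otimes> A e \<otimes> T x = A e \<otimes> T x \<otimes> T x"
    using A_T_commute[of i j x] e assms False by simp
  then show ?thesis using assms False by (simp add: m_assoc T_square)
qed

lemma arc_square:
  assumes "e \<in> pairs n" "p \<in> {0,1}"
  shows "arc (e, p) \<otimes> arc (e, p) = \<one>"
proof -
  obtain i j where e: "e = {i, j}" "i \<in> {1..n}"
    using assms(1) by (rule pairs_cases) auto
  have "arc (e, Suc 0) \<otimes> arc (e, Suc 0) = T i \<otimes> (A e \<otimes> A e) \<otimes> T i"
    using assms(1) e by (simp add: arc_1[of _ i] T_conj_mult)
  then show ?thesis using assms e by (auto simp: A_square T_square)
qed

lemma commute_mult:
  assumes "x \<otimes> a = a \<otimes> x" "x \<otimes> b = b \<otimes> x" "x \<in> carrier K" "a \<in> carrier K" "b \<in> carrier K"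
  shows "x \<otimes> (a \<otimes> b) = (a \<otimes> b) \<otimes> x"
  using assms by (metis m_assoc)

text \<open>Both \<open>A {i,j}\<close> and \<open>T i\<close> commute with \<open>A {k,l}\<close>
  and with \<open>T k\<close>. The arcs are products of such elements, so
  \<open>commute_mult\<close> applies first on one side, then on the other.\<close>

lemma arc_commute:
  assumes "{i,j,k,l} \<subseteq> {1..n}" "distinct [i,j,k,l]" "p \<in> {0,1}" "q \<in> {0,1}"
  shows "arc ({i,j}, p) \<otimes> arc ({k,l}, q) = arc ({k,l}, q) \<otimes> arc ({i,j}, p)"
proof -
  have mem: "{i,j} \<in> pairs n" "{k,l} \<in> pairs n" using assms by (auto simp: pairs_iff)
  have ak: "A {i,j} \<otimes> arc ({k,l}, q) = arc ({k,l}, q) \<otimes> A {i,j}"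
    using assms mem A_commute[of i j k l] A_T_commute[of i j k]
    by (auto simp: arc_1[of _ k] intro!: commute_mult)
  have "A {k,l} \<otimes> T i = T i \<otimes> A {k,l}" using assms A_T_commute[of k l i] by auto
  then have ti: "T i \<otimes> arc ({k,l}, q) = arc ({k,l}, q) \<otimes> T i"
    using assms mem T_commute[of i k]
    by (auto simp: arc_1[of _ k] intro!: commute_mult)
  have "arc ({k,l}, q) \<in> carrier K" using arc_closed assms mem by auto
  then have "arc ({k,l}, q) \<otimes> arc ({i,j}, p) = arc ({i,j}, p) \<otimes> arc ({k,l}, q)"
    using assms mem ak ti by (auto simp: arc_1[of _ i] intro!: commute_mult)
  then show ?thesis ..
qed

text \<open>This is the triangle relation for \<open>A\<close> conjugated by \<open>T x\<close>: the
  conjugation distributes over the factors by \<open>T_conj_mult\<close>, and by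
  \<open>T_conj_arc\<close> it labels exactly the arcs that end in \<open>x\<close>.\<close>

lemma T_conj_triangle:
  assumes "{i,j,k} \<subseteq> {1..n}" "distinct [i,j,k]" "x \<in> {1..n}"
  shows "arc ({i,j}, of_bool (x \<in> {i,j})) \<otimes> arc ({i,k}, of_bool (x \<in> {i,k}))
      \<otimes> arc ({j,k}, of_bool (x \<in> {j,k})) =
    arc ({j,k}, of_bool (x \<in> {j,k})) \<otimes> arc ({i,k}, of_bool (x \<in> {i,k}))
      \<otimes> arc ({i,j}, of_bool (x \<in> {i,j}))"
proof -
  have mem: "{i,j} \<in> pairs n" "{i,k} \<in> pairs n" "{j,k} \<in> pairs n"
    using assms by (auto simp: pairs_iff)
  show ?thesis
    using assms mem A_triangle[of i j k]
    by (simp only: T_conj_arc[symmetric] T_conj_mult A_closed m_closed)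
qed

text \<open>An admissible labelling of a triangle is trivial or obtained from the trivial one by
  conjugation with the \<open>T\<close> of the vertex shared by the two arcs labelled \<open>1\<close>.\<close>

lemma arc_triangle:
  assumes ijk: "{i,j,k} \<subseteq> {1..n}" "distinct [i,j,k]"
    and "p \<in> {0,1}" "q \<in> {0,1}" "r \<in> {0,1}" "(p + q + r) mod 2 = 0"
  shows "arc ({i,j}, p) \<otimes> arc ({i,k}, q) \<otimes> arc ({j,k}, r) =
    arc ({j,k}, r) \<otimes> arc ({i,k}, q) \<otimes> arc ({i,j}, p)"
proof -
  consider "p = 0" "q = 0" "r = 0" | "p = 1" "q = 1" "r = 0" | "p = 1" "q = 0" "r = 1"
    | "p = 0" "q = 1" "r = 1"
    using assms by auto
  then show ?thesis
    by cases (use ijk A_triangle[OF ijk] T_conj_triangle[OF ijk, of i]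
        T_conj_triangle[OF ijk, of j] T_conj_triangle[OF ijk, of k] in auto)
qed

text \<open>The universal property applies to \<open>arc\<close>: its three families of relations
  are \<open>arc_square\<close>, \<open>arc_commute\<close> and \<open>arc_triangle\<close>.\<close>

lemma parity_hom_exists:
  "\<exists>h \<in> hom (G2_parity n) K. \<forall>g \<in> pairs n \<times> {0,1}. h (gen (G2_parity_pres n) g) = arc g"
proof -
  have fst: "fst (G2_parity_pres n) = pairs n \<times> {0,1}"
    by (simp add: G2_parity_pres_def)
  have closed: "arc ({i,j}, p) \<in> carrier K" if "{i,j} \<subseteq> {1..n}" "i \<noteq> j" "p \<in> {0,1}" for i j p
    using that arc_closed by (auto simp: pairs_iff Pi_iff)
  have "eval_word K arc u = eval_word K arc v"
    if uv: "(u, v) \<in> snd (G2_parity_pres n)" for u v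
    using uv unfolding G2_parity_pres_def snd_conv Un_iff mem_Collect_eq
  proof (elim disjE exE conjE; unfold prod.inject; elim conjE)
    fix i j p assume "u = pos [({i,j},p), ({i,j},p)]" "v = []"
      "{i,j} \<subseteq> {1..n}" "i \<noteq> j" "p \<in> {0,1}"
    then show ?thesis using arc_square[of "{i,j}" p] closed[of i j p] by (simp add: pairs_iff)
  next
    fix i j k l p q assume "u = pos [({i,j},p), ({k,l},q)]" "v = pos [({k,l},q), ({i,j},p)]"
      "{i,j,k,l} \<subseteq> {1..n}" "distinct [i,j,k,l]" "{p,q} \<subseteq> {0,1}"
    then show ?thesis
      using arc_commute[of i j k l p q] closed[of i j p] closed[of k l q] by simp
  next
    fix i j k p q r assume "u = pos [({i,j},p), ({i,k},q), ({j,k},r)]"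
      "v = pos [({j,k},r), ({i,k},q), ({i,j},p)]"
      "{i,j,k} \<subseteq> {1..n}" "distinct [i,j,k]" "{p,q,r} \<subseteq> {0,1}" "(p + q + r) mod 2 = 0"
    then show ?thesis
      using arc_triangle[of i j k p q r] closed[of i j p] closed[of i k q] closed[of j k r]
      by (simp add: m_assoc)
  qed
  then show ?thesis
    using presented_group_universal[of arc "G2_parity_pres n"] arc_closed
    by (simp add: G2_parity_def fst)
qed

definition point_eval :: "point_gen \<Rightarrow> 'a" where
  "point_eval g = (case g of Arc e \<Rightarrow> A e | Tau i \<Rightarrow> T i)"

lemma point_eval_simps [simp]: "point_eval (Arc e) = A e" "point_eval (Tau i) = T i"
  by (simp_all add: point_eval_def)

lemma points_hom_exists:
  "\<exists>h \<in> hom (G2_points n) K. (\<forall>e \<in> pairs n. h (gen (G2_points_pres n) (Arc e)) = A e) \<and>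
     (\<forall>i \<in> {1..n}. h (gen (G2_points_pres n) (Tau i)) = T i)"
proof -
  have fst: "fst (G2_points_pres n) = Arc ` pairs n \<union> Tau ` {1..n}"
    by (simp add: G2_points_pres_def)
  have closed: "A {i,j} \<in> carrier K" if "{i,j} \<subseteq> {1..n}" "i \<noteq> j" for i j
    using that by (auto simp: pairs_iff)
  have "eval_word K point_eval u = eval_word K point_eval v"
    if uv: "(u, v) \<in> snd (G2_points_pres n)" for u v
    using uv unfolding G2_points_pres_def snd_conv Un_iff mem_Collect_eq
  proof (elim disjE exE conjE; unfold prod.inject; elim conjE)
    fix i j assume "u = pos [Arc {i,j}, Arc {i,j}]" "v = []" "{i,j} \<subseteq> {1..n}" "i \<noteq> j"
    then show ?thesis using A_square[of "{i,j}"] closed[of i j] by (simp add: pairs_iff)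
  next
    fix i j k l assume "u = pos [Arc {i,j}, Arc {k,l}]" "v = pos [Arc {k,l}, Arc {i,j}]"
      "{i,j,k,l} \<subseteq> {1..n}" "distinct [i,j,k,l]"
    then show ?thesis using A_commute[of i j k l] closed[of i j] closed[of k l] by simp
  next
    fix i j k assume "u = pos [Arc {i,j}, Arc {i,k}, Arc {j,k}]"
      "v = pos [Arc {j,k}, Arc {i,k}, Arc {i,j}]" "{i,j,k} \<subseteq> {1..n}" "distinct [i,j,k]"
    then show ?thesis
      using A_triangle[of i j k] closed[of i j] closed[of i k] closed[of j k]
      by (simp add: m_assoc)
  next
    fix i assume "u = pos [Tau i, Tau i]" "v = []" "i \<in> {1..n}"
    then show ?thesis using T_square by simp
  next
    fix i j assume "u = pos [Tau i, Tau j]" "v = pos [Tau j, Tau i]" "{i,j} \<subseteq> {1..n}"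
    then show ?thesis using T_commute[of i j] by simp
  next
    fix i j assume "u = pos [Tau i, Tau j, Arc {i,j}, Tau j, Tau i]" "v = pos [Arc {i,j}]"
      "{i,j} \<subseteq> {1..n}" "i \<noteq> j"
    then show ?thesis using T_conj_A[of i j] closed[of i j] by (simp add: m_assoc)
  next
    fix i j k assume "u = pos [Arc {i,j}, Tau k]" "v = pos [Tau k, Arc {i,j}]"
      "{i,j,k} \<subseteq> {1..n}" "distinct [i,j,k]"
    then show ?thesis using A_T_commute[of i j k] closed[of i j] by simp
  qed
  moreover have "point_eval \<in> fst (G2_points_pres n) \<rightarrow> carrier K"
    by (auto simp: fst)
  ultimately obtain h where "h \<in> hom (presented_group (G2_points_pres n)) K"
    "\<forall>g \<in> fst (G2_points_pres n). h (gen (G2_points_pres n) g) = point_eval g"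
    using presented_group_universal[of point_eval "G2_points_pres n"] by blast
  then show ?thesis by (intro bexI[of _ h]) (simp_all add: fst G2_points_def)
qed

end

section \<open>The two groups that satisfy the relations with points\<close>

lemma points_relations_G2_points:
  "points_relations (G2_points n) n (\<lambda>e. gen (G2_points_pres n) (Arc e))
     (\<lambda>i. gen (G2_points_pres n) (Tau i))"
proof -
  let ?P = "G2_points_pres n"
  interpret group "presented_group ?P" by (rule group_presented_group)
  have fst: "fst ?P = Arc ` pairs n \<union> Tau ` {1..n}"
    by (simp add: G2_points_pres_def)
  have arc: "Arc {i,j} \<in> fst ?P" if "i \<in> {1..n}" "j \<in> {1..n}" "i \<noteq> j" for i j
    using that by (auto simp: fst pairs_iff)
  have tau: "Tau i \<in> fst ?P" if "i \<in> {1..n}" for i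
    using that by (auto simp: fst)
  note mem = arc tau gen_carrier
  show ?thesis
    unfolding G2_points_def
  proof unfold_locales
    fix e assume e: "e \<in> pairs n"
    then show "gen ?P (Arc e) \<in> carrier (presented_group ?P)"
      by (simp add: gen_carrier fst)
    from e obtain i j where ij: "e = {i, j}" "{i, j} \<subseteq> {1..n}" "i \<noteq> j"
      by (auto elim: pairs_cases)
    have "(pos [Arc e, Arc e], pos []) \<in> snd ?P"
      unfolding G2_points_pres_def snd_conv pos_simps(1) ij(1)
      \<comment> \<open>The union of the seven families associates to the left, so the number of
        \<open>UnI1\<close> steps selects the family; the first one lies deepest.\<close>
      by (rule UnI1, rule UnI1, rule UnI1, rule UnI1, rule UnI1, rule UnI1,
          rule CollectI, intro exI conjI, rule HOL.refl)
        (use ij in auto)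
    from relation_gens[OF this] ij
    show "gen ?P (Arc e) \<otimes>\<^bsub>presented_group ?P\<^esub> gen ?P (Arc e) = \<one>\<^bsub>presented_group ?P\<^esub>"
      by (simp add: mem)
  next
    fix i j k l assume *: "{i,j,k,l} \<subseteq> {1..n}" "distinct [i,j,k,l]"
    have "(pos [Arc {i,j}, Arc {k,l}], pos [Arc {k,l}, Arc {i,j}]) \<in> snd ?P"
      unfolding G2_points_pres_def snd_conv
      by (rule UnI1, rule UnI1, rule UnI1, rule UnI1, rule UnI1, rule UnI2,
          rule CollectI, intro exI conjI, rule HOL.refl)
        (use * in auto)
    from relation_gens[OF this] *
    show "gen ?P (Arc {i,j}) \<otimes>\<^bsub>presented_group ?P\<^esub> gen ?P (Arc {k,l}) =
        gen ?P (Arc {k,l}) \<otimes>\<^bsub>presented_group ?P\<^esub> gen ?P (Arc {i,j})"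
      by (simp add: mem)
  next
    fix i j k assume *: "{i,j,k} \<subseteq> {1..n}" "distinct [i,j,k]"
    have "(pos [Arc {i,j}, Arc {i,k}, Arc {j,k}], pos [Arc {j,k}, Arc {i,k}, Arc {i,j}])
        \<in> snd ?P"
      unfolding G2_points_pres_def snd_conv
      by (rule UnI1, rule UnI1, rule UnI1, rule UnI1, rule UnI2,
          rule CollectI, intro exI conjI, rule HOL.refl)
        (use * in auto)
    from relation_gens[OF this] *
    show "gen ?P (Arc {i,j}) \<otimes>\<^bsub>presented_group ?P\<^esub> gen ?P (Arc {i,k})
          \<otimes>\<^bsub>presented_group ?P\<^esub> gen ?P (Arc {j,k}) =
        gen ?P (Arc {j,k}) \<otimes>\<^bsub>presented_group ?P\<^esub> gen ?P (Arc {i,k})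
          \<otimes>\<^bsub>presented_group ?P\<^esub> gen ?P (Arc {i,j})"
      by (simp add: mem m_assoc)
    have "(pos [Arc {i,j}, Tau k], pos [Tau k, Arc {i,j}]) \<in> snd ?P"
      unfolding G2_points_pres_def snd_conv
      by (rule UnI2, rule CollectI, intro exI conjI, rule HOL.refl)
        (use * in auto)
    from relation_gens[OF this] *
    show "gen ?P (Arc {i,j}) \<otimes>\<^bsub>presented_group ?P\<^esub> gen ?P (Tau k) =
        gen ?P (Tau k) \<otimes>\<^bsub>presented_group ?P\<^esub> gen ?P (Arc {i,j})"
      by (simp add: mem)
  next
    fix i assume i: "i \<in> {1..n}"
    then show "gen ?P (Tau i) \<in> carrier (presented_group ?P)" by (simp add: mem)
    have "(pos [Tau i, Tau i], pos []) \<in> snd ?P"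
      unfolding G2_points_pres_def snd_conv pos_simps(1)
      by (rule UnI1, rule UnI1, rule UnI1, rule UnI2,
          rule CollectI, intro exI conjI, rule HOL.refl)
        (use i in auto)
    from relation_gens[OF this] i
    show "gen ?P (Tau i) \<otimes>\<^bsub>presented_group ?P\<^esub> gen ?P (Tau i) = \<one>\<^bsub>presented_group ?P\<^esub>"
      by (simp add: mem)
  next
    fix i j assume *: "{i,j} \<subseteq> {1..n}"
    have "(pos [Tau i, Tau j], pos [Tau j, Tau i]) \<in> snd ?P"
      unfolding G2_points_pres_def snd_conv
      by (rule UnI1, rule UnI1, rule UnI2, rule CollectI, intro exI conjI, rule HOL.refl)
        (use * in auto)
    from relation_gens[OF this] *
    show "gen ?P (Tau i) \<otimes>\<^bsub>presented_group ?P\<^esub> gen ?P (Tau j) =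
        gen ?P (Tau j) \<otimes>\<^bsub>presented_group ?P\<^esub> gen ?P (Tau i)"
      by (simp add: mem)
    assume "i \<noteq> j"
    have "(pos [Tau i, Tau j, Arc {i,j}, Tau j, Tau i], pos [Arc {i,j}]) \<in> snd ?P"
      unfolding G2_points_pres_def snd_conv
      by (rule UnI1, rule UnI2, rule CollectI, intro exI conjI, rule HOL.refl)
        (use * \<open>i \<noteq> j\<close> in auto)
    from relation_gens[OF this] * \<open>i \<noteq> j\<close>
    show "gen ?P (Tau i) \<otimes>\<^bsub>presented_group ?P\<^esub> gen ?P (Tau j)
          \<otimes>\<^bsub>presented_group ?P\<^esub> gen ?P (Arc {i,j}) \<otimes>\<^bsub>presented_group ?P\<^esub> gen ?P (Tau j)
          \<otimes>\<^bsub>presented_group ?P\<^esub> gen ?P (Tau i) = gen ?P (Arc {i,j})"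
      by (simp add: mem m_assoc)
  qed
qed

text \<open>\<open>A_T_commute\<close> is the commutation of the disjoint pairs \<open>{i,j}\<close>
  and \<open>{k,n+1}\<close>, \<open>T_commute\<close> is the relation added in the quotient, and
  \<open>T_conj_A\<close> comes from the triangle with third vertex \<open>n+1\<close>. The
  remaining relations are inherited.\<close>

lemma points_relations_G2_quot:
  "points_relations (G2_quot n) n (gen (G2_quot_pres n)) (\<lambda>i. gen (G2_quot_pres n) {i, n + 1})"
proof -
  let ?P = "G2_quot_pres n"
  interpret group "presented_group ?P" by (rule group_presented_group)
  have fst: "fst ?P = pairs (n + 1)"
    by (simp add: G2_quot_pres_def G2_pres_def)
  have arc: "{i,j} \<in> fst ?P" if "i \<in> {1..n+1}" "j \<in> {1..n+1}" "i \<noteq> j" for i j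
    unfolding fst pairs_iff using that by blast
  have square: "gen ?P {i,j} \<otimes>\<^bsub>presented_group ?P\<^esub> gen ?P {i,j} = \<one>\<^bsub>presented_group ?P\<^esub>"
    if *: "{i,j} \<subseteq> {1..n+1}" "i \<noteq> j" for i j
  proof -
    have "(pos [{i,j}, {i,j}], pos []) \<in> snd ?P"
      unfolding G2_quot_pres_def G2_pres_def snd_conv pos_simps(1)
      by (rule UnI1, rule UnI1, rule UnI1, rule CollectI, intro exI conjI, rule HOL.refl)
        (use * in auto)
    from relation_gens[OF this] * show ?thesis by (simp add: arc gen_carrier)
  qed
  have commute: "gen ?P {i,j} \<otimes>\<^bsub>presented_group ?P\<^esub> gen ?P {k,l} =
      gen ?P {k,l} \<otimes>\<^bsub>presented_group ?P\<^esub> gen ?P {i,j}"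
    if *: "{i,j,k,l} \<subseteq> {1..n+1}" "distinct [i,j,k,l]" for i j k l
  proof -
    have "(pos [{i,j}, {k,l}], pos [{k,l}, {i,j}]) \<in> snd ?P"
      unfolding G2_quot_pres_def G2_pres_def snd_conv
      by (rule UnI1, rule UnI1, rule UnI2, rule CollectI, intro exI conjI, rule HOL.refl)
        (use * in auto)
    from relation_gens[OF this] * show ?thesis by (simp add: arc gen_carrier)
  qed
  have triangle: "gen ?P {i,j} \<otimes>\<^bsub>presented_group ?P\<^esub> gen ?P {i,k}
        \<otimes>\<^bsub>presented_group ?P\<^esub> gen ?P {j,k} =
      gen ?P {j,k} \<otimes>\<^bsub>presented_group ?P\<^esub> gen ?P {i,k}
        \<otimes>\<^bsub>presented_group ?P\<^esub> gen ?P {i,j}"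
    if *: "{i,j,k} \<subseteq> {1..n+1}" "distinct [i,j,k]" for i j k
  proof -
    have "(pos [{i,j}, {i,k}, {j,k}], pos [{j,k}, {i,k}, {i,j}]) \<in> snd ?P"
      unfolding G2_quot_pres_def G2_pres_def snd_conv
      by (rule UnI1, rule UnI2, rule CollectI, intro exI conjI, rule HOL.refl)
        (use * in auto)
    from relation_gens[OF this] * show ?thesis by (simp add: arc gen_carrier m_assoc)
  qed
  have last_commute: "gen ?P {i,n+1} \<otimes>\<^bsub>presented_group ?P\<^esub> gen ?P {j,n+1} =
      gen ?P {j,n+1} \<otimes>\<^bsub>presented_group ?P\<^esub> gen ?P {i,n+1}"
    if *: "{i,j} \<subseteq> {1..n}" for i j
  proof -
    have "(pos [{i,n+1}, {j,n+1}], pos [{j,n+1}, {i,n+1}]) \<in> snd ?P"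
      unfolding G2_quot_pres_def snd_conv
      by (rule UnI2, rule CollectI, intro exI conjI, rule HOL.refl)
        (use * in auto)
    from relation_gens[OF this] * show ?thesis by (simp add: arc gen_carrier)
  qed
  show ?thesis
    unfolding G2_quot_def
  proof unfold_locales
    fix e assume e: "e \<in> pairs n"
    from e obtain i j where ij: "e = {i, j}" "i \<in> {1..n}" "j \<in> {1..n}" "i < j"
      by (rule pairs_cases)
    then show "gen ?P e \<in> carrier (presented_group ?P)"
      by (simp add: gen_carrier arc)
    show "gen ?P e \<otimes>\<^bsub>presented_group ?P\<^esub> gen ?P e = \<one>\<^bsub>presented_group ?P\<^esub>"
      using square[of i j] ij by simp
  next
    fix i assume i: "i \<in> {1..n}"
    then show "gen ?P {i,n+1} \<in> carrier (presented_group ?P)" by (simp add: arc gen_carrier)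
    show "gen ?P {i,n+1} \<otimes>\<^bsub>presented_group ?P\<^esub> gen ?P {i,n+1} = \<one>\<^bsub>presented_group ?P\<^esub>"
      using square[of i "n+1"] i by simp
  next
    fix i j assume *: "{i,j} \<subseteq> {1..n}" "i \<noteq> j"
    let ?a = "gen ?P {i,j}" and ?s = "gen ?P {i,n+1}" and ?t = "gen ?P {j,n+1}"
    have carr: "?a \<in> carrier (presented_group ?P)" "?s \<in> carrier (presented_group ?P)"
      "?t \<in> carrier (presented_group ?P)"
      using * by (simp_all add: arc gen_carrier)
    have sq: "?s \<otimes>\<^bsub>presented_group ?P\<^esub> ?s = \<one>\<^bsub>presented_group ?P\<^esub>"
      "?t \<otimes>\<^bsub>presented_group ?P\<^esub> ?t = \<one>\<^bsub>presented_group ?P\<^esub>"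
      using square[of i "n+1"] square[of j "n+1"] * by simp_all
    \<comment> \<open>The triangle on \<open>i\<close>, \<open>j\<close>, \<open>n+1\<close> gives
      \<open>?a ?s ?t = ?t ?s ?a\<close>; the added relation replaces \<open>?t ?s\<close> by
      \<open>?s ?t\<close>.\<close>
    have "?s \<otimes>\<^bsub>presented_group ?P\<^esub> ?t \<otimes>\<^bsub>presented_group ?P\<^esub> ?a =
        ?a \<otimes>\<^bsub>presented_group ?P\<^esub> ?s \<otimes>\<^bsub>presented_group ?P\<^esub> ?t"
      using triangle[of i j "n+1"] last_commute[of i j] * by simp
    \<comment> \<open>Multiplication on the right by \<open>?t\<close> and then \<open>?s\<close>,
      whose squares are trivial, isolates \<open>?a\<close>.\<close>
    then have "?s \<otimes>\<^bsub>presented_group ?P\<^esub> ?t \<otimes>\<^bsub>presented_group ?P\<^esub> ?a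
        \<otimes>\<^bsub>presented_group ?P\<^esub> ?t \<otimes>\<^bsub>presented_group ?P\<^esub> ?s =
        ?a \<otimes>\<^bsub>presented_group ?P\<^esub> ?s \<otimes>\<^bsub>presented_group ?P\<^esub>
          (?t \<otimes>\<^bsub>presented_group ?P\<^esub> ?t) \<otimes>\<^bsub>presented_group ?P\<^esub> ?s"
      using carr by (simp add: m_assoc)
    also have "\<dots> = ?a"
      using carr sq by (simp add: m_assoc)
    finally show "?s \<otimes>\<^bsub>presented_group ?P\<^esub> ?t \<otimes>\<^bsub>presented_group ?P\<^esub> ?a
        \<otimes>\<^bsub>presented_group ?P\<^esub> ?t \<otimes>\<^bsub>presented_group ?P\<^esub> ?s = ?a" .
  next
    fix i j k assume *: "{i,j,k} \<subseteq> {1..n}" "distinct [i,j,k]"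
    then show "gen ?P {i,j} \<otimes>\<^bsub>presented_group ?P\<^esub> gen ?P {k,n+1} =
        gen ?P {k,n+1} \<otimes>\<^bsub>presented_group ?P\<^esub> gen ?P {i,j}"
      by (intro commute) auto
  next
    fix i j k l assume "{i,j,k,l} \<subseteq> {1..n}" "distinct [i,j,k,l]"
    then show "gen ?P {i,j} \<otimes>\<^bsub>presented_group ?P\<^esub> gen ?P {k,l} =
        gen ?P {k,l} \<otimes>\<^bsub>presented_group ?P\<^esub> gen ?P {i,j}"
      by (intro commute) auto
  next
    fix i j k assume "{i,j,k} \<subseteq> {1..n}" "distinct [i,j,k]"
    then show "gen ?P {i,j} \<otimes>\<^bsub>presented_group ?P\<^esub> gen ?P {i,k}
          \<otimes>\<^bsub>presented_group ?P\<^esub> gen ?P {j,k} =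
        gen ?P {j,k} \<otimes>\<^bsub>presented_group ?P\<^esub> gen ?P {i,k}
          \<otimes>\<^bsub>presented_group ?P\<^esub> gen ?P {i,j}"
      by (intro triangle) auto
  qed (rule last_commute)
qed

text \<open>The target group supplies its own \<open>A\<close> and \<open>T\<close>;
  \<open>arc_1\<close> turns label \<open>1\<close> into conjugation by
  \<open>Tau i\<close>.\<close>

lemma phi_exists: "\<exists>\<phi>. is_phi n \<phi>"
proof -
  let ?A = "\<lambda>e. gen (G2_points_pres n) (Arc e)" and ?T = "\<lambda>i. gen (G2_points_pres n) (Tau i)"
  interpret points_relations "G2_points n" n ?A ?T
    by (rule points_relations_G2_points)
  obtain h where h: "h \<in> hom (G2_parity n) (G2_points n)"
    "\<forall>g \<in> pairs n \<times> {0,1}. h (gen (G2_parity_pres n) g) = arc g"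
    using parity_hom_exists by blast
  have "is_phi n h"
    unfolding is_phi_def using h by (auto simp: pairs_iff arc_1)
  then show ?thesis by blast
qed

lemma omega_exists: "\<exists>\<omega>. is_omega n \<omega>"
proof -
  interpret points_relations "G2_quot n" n "gen (G2_quot_pres n)"
    "\<lambda>i. gen (G2_quot_pres n) {i, n + 1}"
    by (rule points_relations_G2_quot)
  obtain h where "h \<in> hom (G2_points n) (G2_quot n)"
    "\<forall>e \<in> pairs n. h (gen (G2_points_pres n) (Arc e)) = gen (G2_quot_pres n) e"
    "\<forall>i \<in> {1..n}. h (gen (G2_points_pres n) (Tau i)) = gen (G2_quot_pres n) {i, n + 1}"
    using points_hom_exists by blast
  then have "is_omega n h"
    by (simp add: is_omega_def pairs_iff)
  then show ?thesis by blast
qed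

section \<open>The left inverse on words\<close>

definition label :: "nat set \<Rightarrow> nat set \<Rightarrow> nat" where
  "label s e = card (e \<inter> s) mod 2"

lemma label_pair: "i \<noteq> j \<Longrightarrow> label s {i,j} = (if i \<in> s \<longleftrightarrow> j \<in> s then 0 else 1)"
  by (auto simp: label_def Int_insert_left)

lemma label_bit: "label s e \<in> {0,1}"
  by (auto simp: label_def)

text \<open>The $(Z/2)^n$ component of the map to the semidirect product. For
  \<open>e = {i,m}\<close> the set \<open>e - {m}\<close> is \<open>{i}\<close>, so the symmetric
  difference flips \<open>i\<close>; both signs of a letter flip alike, a flip being its own
  inverse.\<close>

fun toggled :: "nat \<Rightarrow> nat set \<Rightarrow> nat set word \<Rightarrow> nat set" where
  "toggled m s [] = s"
| "toggled m s ((e, b) # w) = toggled m (if m \<in> e then sym_diff s (e - {m}) else s) w"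

text \<open>The $G_{n,p}^2$ component, kept as a word. The starting set \<open>s\<close> is a
  parameter so that the rest of a word can be read from the state its prefix leaves behind.\<close>

fun labelled :: "nat \<Rightarrow> nat set \<Rightarrow> nat set word \<Rightarrow> (nat set \<times> nat) word" where
  "labelled m s [] = []"
| "labelled m s ((e, b) # w) =
    (if m \<in> e then labelled m (sym_diff s (e - {m})) w
     else ((e, label s e), b) # labelled m s w)"

lemma toggled_append: "toggled m s (u @ v) = toggled m (toggled m s u) v"
  by (induction m s u rule: toggled.induct) auto

text \<open>The multiplication rule of the semidirect product: the state left by the first factor
  acts on the labels of the second.\<close>

lemma labelled_append: "labelled m s (u @ v) = labelled m s u @ labelled m (toggled m s u) v"
  by (induction m s u rule: labelled.induct) auto

lemma labelled_words:
  "w \<in> words (pairs (n + 1)) \<Longrightarrow> labelled (n + 1) s w \<in> words (pairs n \<times> {0,1})"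
proof (induction "n + 1" s w rule: labelled.induct)
  case (2 s e b w)
  show ?case
  proof (cases "n + 1 \<in> e")
    case True
    then show ?thesis using 2 by simp
  next
    case False
    moreover have "e \<in> pairs n"
    proof -
      obtain i j where ij: "e = {i, j}" "i \<in> {1..n+1}" "j \<in> {1..n+1}" "i < j"
        using 2(3) by (auto elim: pairs_cases)
      with False show ?thesis by (auto simp: pairs_iff)
    qed
    ultimately show ?thesis using 2 label_bit[of s e] by simp
  qed
qed simp

section \<open>Invariance of the labelling under the relations\<close>

lemma sym_diff_cancel: "sym_diff (sym_diff s a) a = s"
  by blast

text \<open>Every \<open>s\<close> is covered, since a relation may be applied in the middle of a
  word. Relations without \<open>n+1\<close> become relations of $G_{n,p}^2$; in all others both
  sides give literally the same labelled word.\<close>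

lemma labelled_rel:
  assumes "(u, v) \<in> snd (G2_quot_pres n)"
  shows "toggled (n+1) s u = toggled (n+1) s v \<and>
    pres_eq (G2_parity_pres n) (labelled (n+1) s u) (labelled (n+1) s v)"
proof -
  let ?m = "n + 1" and ?Q = "G2_parity_pres n"
  have fst: "fst ?Q = pairs n \<times> {0,1}"
    by (simp add: G2_parity_pres_def)
  have mem: "({i,j}, label t {i,j}) \<in> fst ?Q"
    if "i \<in> {1..n}" "j \<in> {1..n}" "i \<noteq> j" for i j t
    using that label_bit[of t "{i,j}"] by (auto simp: fst pairs_iff)
  have reflI: "pres_eq ?Q x y" if "x = y" "x \<in> words (fst ?Q)" for x y
    using that by (auto intro: pres_eq.refl)
  have relI: "pres_eq ?Q x y" if "(x, y) \<in> snd ?Q" "x \<in> words (fst ?Q)" "y \<in> words (fst ?Q)" for x y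
    using that by (rule pres_eq.rel)
  show ?thesis
    using assms unfolding G2_quot_pres_def G2_pres_def snd_conv fst_conv Un_iff mem_Collect_eq
  proof (elim disjE exE conjE; unfold prod.inject; elim conjE)
    fix i j assume *: "u = pos [{i,j}, {i,j}]" "v = []" "{i,j} \<subseteq> {1..?m}" "i \<noteq> j"
    show ?thesis
    proof (cases "?m \<in> {i,j}")
      case True
      with * show ?thesis by (simp add: sym_diff_cancel pres_eq.refl)
    next
      case False
      then have sub: "{i,j} \<subseteq> {1..n}" using * by (auto simp: le_Suc_eq)
      have "(pos [({i,j}, label s {i,j}), ({i,j}, label s {i,j})], []) \<in> snd ?Q"
        unfolding G2_parity_pres_def snd_conv
        by (rule UnI1, rule UnI1, rule CollectI, intro exI conjI, rule HOL.refl)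
          (use sub * label_bit[of s "{i,j}"] in auto)
      with False sub * show ?thesis by (auto intro!: relI mem)
    qed
  next
    fix i j k l assume *: "u = pos [{i,j}, {k,l}]" "v = pos [{k,l}, {i,j}]"
      "{i,j,k,l} \<subseteq> {1..?m}" "distinct [i,j,k,l]"
    \<comment> \<open>The four indices are distinct, so at most one of the two pairs contains
      \<open>n+1\<close>.\<close>
    consider "?m \<in> {i,j}" "?m \<notin> {k,l}" | "?m \<in> {k,l}" "?m \<notin> {i,j}" | "?m \<notin> {i,j,k,l}"
      using * by auto
    then show ?thesis
    proof cases
      case 3
      then have sub: "{i,j,k,l} \<subseteq> {1..n}" using * by (auto simp: le_Suc_eq)
      have "(pos [({i,j}, label s {i,j}), ({k,l}, label s {k,l})],
          pos [({k,l}, label s {k,l}), ({i,j}, label s {i,j})]) \<in> snd ?Q"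
        unfolding G2_parity_pres_def snd_conv
        by (rule UnI1, rule UnI2, rule CollectI, intro exI conjI, rule HOL.refl)
          (use sub * label_bit[of s "{i,j}"] label_bit[of s "{k,l}"] in auto)
      with 3 sub * show ?thesis by (auto intro!: relI mem)
    \<comment> \<open>A pair containing \<open>n+1\<close> flips an index outside the other pair,
      whose label therefore stays the same.\<close>
    qed (use * in \<open>auto simp: label_pair fst pairs_iff le_Suc_eq intro!: reflI\<close>)
  next
    fix i j k assume *: "u = pos [{i,j}, {i,k}, {j,k}]" "v = pos [{j,k}, {i,k}, {i,j}]"
      "{i,j,k} \<subseteq> {1..?m}" "distinct [i,j,k]"
    consider "?m = i" "?m \<noteq> j" "?m \<noteq> k" | "?m = j" "?m \<noteq> i" "?m \<noteq> k"
      | "?m = k" "?m \<noteq> i" "?m \<noteq> j" | "?m \<notin> {i,j,k}"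
      using * by auto
    then show ?thesis
    proof cases
      case 4
      then have sub: "{i,j,k} \<subseteq> {1..n}" using * by (auto simp: le_Suc_eq)
      \<comment> \<open>Each vertex lies on exactly two of the three arcs, so its membership in
        \<open>s\<close> is counted twice.\<close>
      have parity: "(label s {i,j} + label s {i,k} + label s {j,k}) mod 2 = 0"
        using * by (auto simp: label_pair)
      have "(pos [({i,j}, label s {i,j}), ({i,k}, label s {i,k}), ({j,k}, label s {j,k})],
          pos [({j,k}, label s {j,k}), ({i,k}, label s {i,k}), ({i,j}, label s {i,j})]) \<in> snd ?Q"
        unfolding G2_parity_pres_def snd_conv
        by (rule UnI2, rule CollectI, intro exI conjI, rule HOL.refl)
          (use sub * parity label_bit[of s "{i,j}"] label_bit[of s "{i,k}"]
            label_bit[of s "{j,k}"] in auto)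
      with 4 sub * show ?thesis by (auto intro!: relI mem)
    \<comment> \<open>With one vertex equal to \<open>n+1\<close>, the two sides read the surviving
      arc in states that differ by flipping both of its endpoints, which preserves its
      label.\<close>
    qed (use * in \<open>auto simp: label_pair fst pairs_iff le_Suc_eq intro!: reflI\<close>)
  next
    fix i j assume "u = pos [{i,?m}, {j,?m}]" "v = pos [{j,?m}, {i,?m}]" "{i,j} \<subseteq> {1..n}"
    \<comment> \<open>Both words lose all their letters, and the two flips commute.\<close>
    then show ?thesis by (auto intro!: pres_eq.refl)
  qed
qed

text \<open>Well-definedness of the left inverse on classes. State and labelled word are treated
  together, with \<open>s\<close> arbitrary: in the case \<open>mult\<close> the second factors are
  read from the states left by the first ones, and these must agree.\<close>

lemma labelled_cong:
  assumes "pres_eq (G2_quot_pres n) u v"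
  shows "toggled (n+1) s u = toggled (n+1) s v \<and>
    pres_eq (G2_parity_pres n) (labelled (n+1) s u) (labelled (n+1) s v)"
  using assms
proof (induction arbitrary: s)
  case (refl w)
  then have "labelled (n+1) s w \<in> words (fst (G2_parity_pres n))"
    using labelled_words[of w n s] by (simp add: G2_quot_pres_def G2_pres_def G2_parity_pres_def)
  then show ?case by (simp add: pres_eq.refl)
next
  case (mult u u' v v')
  then show ?case by (simp add: toggled_append labelled_append pres_eq.mult)
next
  case (cancel g b)
  then have "[(g, b)] \<in> words (pairs (n + 1))"
    by (simp add: G2_quot_pres_def G2_pres_def)
  \<comment> \<open>If \<open>g\<close> contains \<open>n+1\<close>, the same index is flipped
    twice; otherwise both letters get the same label and cancel, the state being unchanged in
    between.\<close>
  from labelled_words[OF this, of s] show ?case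
    by (auto simp: sym_diff_cancel G2_parity_pres_def intro!: pres_eq.refl pres_eq.cancel)
next
  case (rel u v)
  then show ?case by (intro labelled_rel)
qed (metis pres_eq.sym pres_eq.trans)+

section \<open>Injectivity of the composition\<close>

text \<open>The exact form matters: reading \<open>u\<close> from \<open>{}\<close> returns the
  letter itself, not merely an equivalent word, and restores the state \<open>{}\<close>, so such
  words can be concatenated.\<close>

lemma phi_omega_letter:
  assumes "is_phi n \<phi>" "is_omega n \<omega>" "g \<in> pairs n \<times> {0,1}"
  shows "\<exists>u \<in> words (fst (G2_quot_pres n)).
    \<omega> (\<phi> (word_class (G2_parity_pres n) [(g, b)])) = word_class (G2_quot_pres n) u \<and>
    toggled (n+1) {} u = {} \<and> labelled (n+1) {} u = [(g, b)]"
proof -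
  let ?Q = "G2_parity_pres n" and ?P = "G2_quot_pres n"
  interpret Q: group "presented_group ?Q" by (rule group_presented_group)
  interpret P: group "presented_group ?P" by (rule group_presented_group)
  interpret D: group "presented_group (G2_points_pres n)" by (rule group_presented_group)
  have "\<phi> \<in> hom (presented_group ?Q) (presented_group (G2_points_pres n))"
    and \<omega>: "\<omega> \<in> hom (presented_group (G2_points_pres n)) (presented_group ?P)"
    using assms by (auto simp: is_phi_def is_omega_def G2_parity_def G2_points_def G2_quot_def)
  then interpret h: group_hom "presented_group ?Q" "presented_group ?P" "\<omega> \<circ> \<phi>"
    by unfold_locales (rule hom_compose)
  interpret \<omega>: group_hom "presented_group (G2_points_pres n)" "presented_group ?P" \<omega>
    by unfold_locales (rule \<omega>)
  obtain e p where g: "g = (e, p)" "e \<in> pairs n" "p \<in> {0,1}" using assms by auto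
  obtain i j where e: "e = {i, j}" "i \<in> {1..n}" "j \<in> {1..n}" "i < j"
    using g(2) by (rule pairs_cases)
  have gQ: "g \<in> fst ?Q" using assms by (simp add: G2_parity_pres_def)
  have mem: "{i,j} \<in> fst ?P" "{i,n+1} \<in> fst ?P"
    unfolding G2_quot_pres_def G2_pres_def fst_conv pairs_iff using e by auto
  have memD: "Arc {i,j} \<in> fst (G2_points_pres n)" "Tau i \<in> fst (G2_points_pres n)"
    using e by (auto simp: G2_points_pres_def pairs_iff)
  \<comment> \<open>Both words are palindromes. Inversion reverses the order and negates the signs,
    so \<open>?u False\<close> represents the inverse of \<open>?u True\<close>.\<close>
  let ?u = "\<lambda>b. if p = 0 then [({i,j}, b)] else [({i,n+1}, b), ({i,j}, b), ({i,n+1}, b)]"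
  have True_case: "\<omega> (\<phi> (gen ?Q g)) = word_class ?P (?u True)"
  proof (cases "p = 0")
    case True
    then show ?thesis using assms(1,2) e g by (simp add: is_phi_def is_omega_def gen_def)
  next
    case False
    then have "\<omega> (\<phi> (gen ?Q g)) = gen ?P {i,n+1} \<otimes>\<^bsub>presented_group ?P\<^esub> gen ?P {i,j}
        \<otimes>\<^bsub>presented_group ?P\<^esub> gen ?P {i,n+1}"
      using assms(1,2) e g memD
      by (simp add: is_phi_def is_omega_def G2_points_def gen_carrier)
    with False mem show ?thesis by (simp add: gen_def mult_word_class)
  qed
  have inv: "word_class ?P (?u False) = inv\<^bsub>presented_group ?P\<^esub> word_class ?P (?u True)"
  proof (cases "p = 0")
    case True
    then show ?thesis using mem by (simp add: word_class_inverse_letter gen_def)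
  next
    case False
    have "word_class ?P (?u b) = word_class ?P [({i,n+1}, b)] \<otimes>\<^bsub>presented_group ?P\<^esub>
        (word_class ?P [({i,j}, b)] \<otimes>\<^bsub>presented_group ?P\<^esub> word_class ?P [({i,n+1}, b)])" for b
      using False mem by (simp add: mult_word_class)
    then show ?thesis
      using mem by (simp add: word_class_inverse_letter P.inv_mult_group P.m_assoc
          gen_carrier flip: gen_def)
  qed
  have "\<omega> (\<phi> (word_class ?Q [(g, b)])) = word_class ?P (?u b)"
  proof (cases b)
    case True
    then show ?thesis using True_case by (simp add: gen_def)
  next
    case False
    have "\<omega> (\<phi> (inv\<^bsub>presented_group ?Q\<^esub> gen ?Q g)) =
        inv\<^bsub>presented_group ?P\<^esub> \<omega> (\<phi> (gen ?Q g))"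
      using h.hom_inv[OF gen_carrier[OF gQ]] by simp
    with False show ?thesis
      by (simp only: word_class_inverse_letter[OF gQ] True_case inv)
  qed
  moreover have "?u b \<in> words (fst ?P)" using mem by simp
  \<comment> \<open>For \<open>p = 1\<close> the state between the two letters
    \<open>{i,n+1}\<close> is \<open>{i}\<close>, which gives \<open>{i,j}\<close> the label
    \<open>1\<close>; the last letter restores \<open>{}\<close>.\<close>
  moreover have "toggled (n+1) {} (?u b) = {} \<and> labelled (n+1) {} (?u b) = [(g, b)]"
    using e g by (auto simp: label_pair)
  ultimately show ?thesis by blast
qed

text \<open>The words for the single letters are concatenated; each leaves the state
  \<open>{}\<close>, so \<open>labelled_append\<close> reads every piece from
  \<open>{}\<close>.\<close>

lemma phi_omega_word:
  assumes "is_phi n \<phi>" "is_omega n \<omega>"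
  shows "w \<in> words (pairs n \<times> {0,1}) \<Longrightarrow> \<exists>u \<in> words (fst (G2_quot_pres n)).
    \<omega> (\<phi> (word_class (G2_parity_pres n) w)) = word_class (G2_quot_pres n) u \<and>
    toggled (n+1) {} u = {} \<and> labelled (n+1) {} u = w"
proof (induction w)
  let ?Q = "G2_parity_pres n" and ?P = "G2_quot_pres n"
  have fst: "fst ?Q = pairs n \<times> {0,1}" by (simp add: G2_parity_pres_def)
  have "\<phi> \<in> hom (presented_group ?Q) (presented_group (G2_points_pres n))"
    "\<omega> \<in> hom (presented_group (G2_points_pres n)) (presented_group ?P)"
    using assms by (auto simp: is_phi_def is_omega_def G2_parity_def G2_points_def G2_quot_def)
  then have hom: "\<omega> \<circ> \<phi> \<in> hom (presented_group ?Q) (presented_group ?P)"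
    by (rule hom_compose)
  {
    case Nil
    have "(\<omega> \<circ> \<phi>) (word_class ?Q []) = word_class ?P []"
      using hom_one[OF hom group_presented_group group_presented_group]
      by (simp add: presented_group_simps)
    then show ?case by (intro bexI[of _ "[]"]) auto
  next
    case (Cons x w)
    obtain g b where x: "x = (g, b)" by (rule prod.exhaust)
    obtain u where u: "u \<in> words (fst ?P)" "\<omega> (\<phi> (word_class ?Q w)) = word_class ?P u"
      "toggled (n+1) {} u = {}" "labelled (n+1) {} u = w"
      using Cons by auto
    obtain u' where u': "u' \<in> words (fst ?P)" "\<omega> (\<phi> (word_class ?Q [x])) = word_class ?P u'"
      "toggled (n+1) {} u' = {}" "labelled (n+1) {} u' = [x]"
      using phi_omega_letter[OF assms, of g b] Cons.prems x by auto
    have "word_class ?Q (x # w) = word_class ?Q [x] \<otimes>\<^bsub>presented_group ?Q\<^esub> word_class ?Q w"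
      using Cons.prems by (simp add: mult_word_class fst)
    moreover have "word_class ?Q [x] \<in> carrier (presented_group ?Q)"
      "word_class ?Q w \<in> carrier (presented_group ?Q)"
      using Cons.prems by (auto intro!: word_class_carrier simp: fst)
    ultimately have "\<omega> (\<phi> (word_class ?Q (x # w))) = word_class ?P (u' @ u)"
      using hom_mult[OF hom] u u' by (simp add: mult_word_class)
    with u u' show ?case
      by (intro bexI[of _ "u' @ u"]) (simp_all add: toggled_append labelled_append)
  }
qed

text \<open>The existence clauses say that both assignments on generators extend to homomorphisms,
  so the last clause speaks of actual maps.\<close>

theorem mainTheorem9:
  fixes n :: nat
  assumes "n \<ge> 1"
  shows "(\<exists>\<phi>. is_phi n \<phi>) \<and> (\<exists>\<omega>. is_omega n \<omega>) \<and>
    (\<forall>\<phi> \<omega>. is_phi n \<phi> \<and> is_omega n \<omega> \<longrightarrow> \<omega> \<circ> \<phi> \<in> mon (G2_parity n) (G2_quot n))"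
proof (intro conjI allI impI phi_exists omega_exists; elim conjE)
  fix \<phi> \<omega> assume \<phi>: "is_phi n \<phi>" and \<omega>: "is_omega n \<omega>"
  let ?Q = "G2_parity_pres n" and ?P = "G2_quot_pres n"
  have fst: "fst ?Q = pairs n \<times> {0,1}" by (simp add: G2_parity_pres_def)
  have "\<omega> \<circ> \<phi> \<in> hom (G2_parity n) (G2_quot n)"
    using \<phi> \<omega> by (auto simp: is_phi_def is_omega_def intro: hom_compose)
  moreover have "inj_on (\<omega> \<circ> \<phi>) (carrier (G2_parity n))"
  proof (rule inj_onI)
    fix x y assume "x \<in> carrier (G2_parity n)" "y \<in> carrier (G2_parity n)"
      and eq: "(\<omega> \<circ> \<phi>) x = (\<omega> \<circ> \<phi>) y"
    then obtain w v where w: "w \<in> words (fst ?Q)" "x = word_class ?Q w"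
      and v: "v \<in> words (fst ?Q)" "y = word_class ?Q v"
      by (auto simp: G2_parity_def presented_group_simps)
    obtain w' where w': "w' \<in> words (fst ?P)" "\<omega> (\<phi> x) = word_class ?P w'"
      "labelled (n+1) {} w' = w"
      using phi_omega_word[OF \<phi> \<omega>] w by (auto simp: fst)
    obtain v' where v': "v' \<in> words (fst ?P)" "\<omega> (\<phi> y) = word_class ?P v'"
      "labelled (n+1) {} v' = v"
      using phi_omega_word[OF \<phi> \<omega>] v by (auto simp: fst)
    have "pres_eq ?P w' v'"
      using eq w' v' by (simp flip: word_class_eq_iff)
    \<comment> \<open>Labelling from \<open>{}\<close> undoes the composition: it takes
      \<open>w'\<close> and \<open>v'\<close> back to \<open>w\<close> and \<open>v\<close>, and
      \<open>labelled_cong\<close> preserves their equivalence.\<close>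
    then have "pres_eq ?Q w v"
      using labelled_cong[of n w' v' "{}"] w' v' by simp
    then show "x = y" using w v by (simp add: word_class_eq_iff)
  qed
  ultimately show "\<omega> \<circ> \<phi> \<in> mon (G2_parity n) (G2_quot n)"
    by (simp add: mon_def)
qed

end
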